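(* There exists a binary chores instance with two agents and two chores in which no randomized allocation that is ex-ante EF and ex-ante EQ is ex-post EFX, and no randomized allocation that is ex-ante EF and ex-ante EQ is ex-post EQX. Consequently, in the guarantee that every (not necessarily normalized) restricted-additive chores instance admits a randomized allocation that is ex-ante EF, ex-ante EQ, and ex-post EF1 and EQ1, neither ex-post EF1 can be strengthened to ex-post EFX nor ex-post EQ1 to ex-post EQX.
   Context: An instance consists of agents $N=\{1,\dots,n\}$, a finite set $M$ of indivisible items, and for each agent $i$ an additive valuation $v_i:2^M\to\mathbb{R}$, i.e. $v_i(\emptyset)=0$ and $v_i(S)=\sum_{o\in S}v_i(o)$. It is a chores instance if $v_i(o)\le 0$ for all $i,o$; a binary chores instance if $v_i(o)\in\{0,-1\}$ for all $i,o$; and a restricted-additive chores instance if it is a chores instance and each item $o$ has a base value $v(o)$ with $v_i(o)\in\{0,v(o)\}$ for every agent $i$. Normalized means $v_i(M)=v_j(M)$ for all $i,j$; it is not assumed here. An allocation $A=(A_1,\dots,A_n)$ is a partition of $M$ into $n$ pairwise disjoint, possibly empty bundles with union $M$. For chores: $A$ is EF1 (respectively EFX) if for all $i,j\in N$ with $A_i\neq\emptyset$, $v_i(A_i\setminus\{c\})\ge v_i(A_j)$ holds for some (respectively every) $c\in A_i$. $A$ is EQ1 (respectively EQX) if for all $i,j\in N$ with $A_i\neq\emptyset$, $v_i(A_i\setminus\{c\})\ge v_j(A_j)$ holds for some (respectively every) $c\in A_i$. A randomized allocation is a probability distribution over deterministic allocations $A^{(1)},\dots,A^{(k)}$ with probabilities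 $p_1,\dots,p_k\in[0,1]$, $\sum_\ell p_\ell=1$. It is ex-ante EQ if $\sum_\ell p_\ell v_i(A_i^{(\ell)})=\sum_\ell p_\ell v_j(A_j^{(\ell)})$ for all $i,j\in N$, and ex-ante EF if $\sum_\ell p_\ell v_i(A_i^{(\ell)})\ge\sum_\ell p_\ell v_i(A_j^{(\ell)})$ for all $i,j\in N$. It satisfies a property ex-post if every allocation in its support satisfies that property. *)

theory Defs
  imports "HOL-Probability.Probability"
begin

text \<open>
  An instance is given by the number \<open>n\<close> of agents, the set \<open>M\<close> of items and the profile \<open>v\<close> of
  valuations, where \<open>v i S\<close> is the value of agent \<open>i\<close> for the bundle \<open>S\<close>.  The values of \<open>v\<close> at
  agents outside \<open>{1..n}\<close> or bundles not contained in \<open>M\<close> play no role.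
\<close>

definition agents :: "nat \<Rightarrow> nat set" where
  "agents n = {1..n}"

definition additive_on :: "'a set \<Rightarrow> ('a set \<Rightarrow> real) \<Rightarrow> bool" where
  "additive_on M u \<longleftrightarrow> u {} = 0 \<and> (\<forall>S \<subseteq> M. u S = (\<Sum>c\<in>S. u {c}))"

definition fair_instance :: "nat \<Rightarrow> 'a set \<Rightarrow> (nat \<Rightarrow> 'a set \<Rightarrow> real) \<Rightarrow> bool" where
  "fair_instance n M v \<longleftrightarrow> n \<ge> 1 \<and> finite M \<and> (\<forall>i\<in>agents n. additive_on M (v i))"

definition chores_instance :: "nat \<Rightarrow> 'a set \<Rightarrow> (nat \<Rightarrow> 'a set \<Rightarrow> real) \<Rightarrow> bool" where
  "chores_instance n M v \<longleftrightarrow>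
     fair_instance n M v \<and> (\<forall>i\<in>agents n. \<forall>c\<in>M. v i {c} \<le> 0)"

definition binary_chores_instance :: "nat \<Rightarrow> 'a set \<Rightarrow> (nat \<Rightarrow> 'a set \<Rightarrow> real) \<Rightarrow> bool" where
  "binary_chores_instance n M v \<longleftrightarrow>
     fair_instance n M v \<and> (\<forall>i\<in>agents n. \<forall>c\<in>M. v i {c} \<in> {0, -1})"

definition restricted_additive_chores_instance ::
    "nat \<Rightarrow> 'a set \<Rightarrow> (nat \<Rightarrow> 'a set \<Rightarrow> real) \<Rightarrow> bool" where
  "restricted_additive_chores_instance n M v \<longleftrightarrow>
     chores_instance n M v \<and>
     (\<exists>b :: 'a \<Rightarrow> real. \<forall>i\<in>agents n. \<forall>c\<in>M. v i {c} \<in> {0, b c})"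

definition allocation :: "nat \<Rightarrow> 'a set \<Rightarrow> (nat \<Rightarrow> 'a set) \<Rightarrow> bool" where
  "allocation n M A \<longleftrightarrow> disjoint_family_on A (agents n) \<and> (\<Union>i\<in>agents n. A i) = M"

definition EF1 :: "nat \<Rightarrow> (nat \<Rightarrow> 'a set \<Rightarrow> real) \<Rightarrow> (nat \<Rightarrow> 'a set) \<Rightarrow> bool" where
  "EF1 n v A \<longleftrightarrow> (\<forall>i\<in>agents n. \<forall>j\<in>agents n. A i \<noteq> {} \<longrightarrow>
     (\<exists>c\<in>A i. v i (A i - {c}) \<ge> v i (A j)))"

definition EFX :: "nat \<Rightarrow> (nat \<Rightarrow> 'a set \<Rightarrow> real) \<Rightarrow> (nat \<Rightarrow> 'a set) \<Rightarrow> bool" where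
  "EFX n v A \<longleftrightarrow> (\<forall>i\<in>agents n. \<forall>j\<in>agents n. A i \<noteq> {} \<longrightarrow>
     (\<forall>c\<in>A i. v i (A i - {c}) \<ge> v i (A j)))"

definition EQ1 :: "nat \<Rightarrow> (nat \<Rightarrow> 'a set \<Rightarrow> real) \<Rightarrow> (nat \<Rightarrow> 'a set) \<Rightarrow> bool" where
  "EQ1 n v A \<longleftrightarrow> (\<forall>i\<in>agents n. \<forall>j\<in>agents n. A i \<noteq> {} \<longrightarrow>
     (\<exists>c\<in>A i. v i (A i - {c}) \<ge> v j (A j)))"

definition EQX :: "nat \<Rightarrow> (nat \<Rightarrow> 'a set \<Rightarrow> real) \<Rightarrow> (nat \<Rightarrow> 'a set) \<Rightarrow> bool" where
  "EQX n v A \<longleftrightarrow> (\<forall>i\<in>agents n. \<forall>j\<in>agents n. A i \<noteq> {} \<longrightarrow>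
     (\<forall>c\<in>A i. v i (A i - {c}) \<ge> v j (A j)))"

text \<open>
  Finiteness of the support is a genuine condition here, since an allocation is a total function
  whose values outside \<open>agents n\<close> are arbitrary.
\<close>

definition randomized_allocation :: "nat \<Rightarrow> 'a set \<Rightarrow> (nat \<Rightarrow> 'a set) pmf \<Rightarrow> bool" where
  "randomized_allocation n M D \<longleftrightarrow> finite (set_pmf D) \<and> (\<forall>A\<in>set_pmf D. allocation n M A)"

definition ex_ante_EF :: "nat \<Rightarrow> (nat \<Rightarrow> 'a set \<Rightarrow> real) \<Rightarrow> (nat \<Rightarrow> 'a set) pmf \<Rightarrow> bool" where
  "ex_ante_EF n v D \<longleftrightarrow> (\<forall>i\<in>agents n. \<forall>j\<in>agents n.
     measure_pmf.expectation D (\<lambda>A. v i (A i)) \<ge> measure_pmf.expectation D (\<lambda>A. v i (A j)))"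

definition ex_ante_EQ :: "nat \<Rightarrow> (nat \<Rightarrow> 'a set \<Rightarrow> real) \<Rightarrow> (nat \<Rightarrow> 'a set) pmf \<Rightarrow> bool" where
  "ex_ante_EQ n v D \<longleftrightarrow> (\<forall>i\<in>agents n. \<forall>j\<in>agents n.
     measure_pmf.expectation D (\<lambda>A. v i (A i)) = measure_pmf.expectation D (\<lambda>A. v j (A j)))"

definition ex_post :: "((nat \<Rightarrow> 'a set) \<Rightarrow> bool) \<Rightarrow> (nat \<Rightarrow> 'a set) pmf \<Rightarrow> bool" where
  "ex_post P D \<longleftrightarrow> (\<forall>A\<in>set_pmf D. P A)"

end

theory Submission
  imports Defs
begin

text \<open>
  Let agent 1 dislike both chores and agent 2 only chore 1.  Giving both chores to one agent violates
  EFX and EQX, so ex post each agent gets exactly one chore and agent 1 has value -1.  By ex-ante EQ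
  agent 2 also has expected value -1, so agent 2 always gets chore 1 and envies agent 1.
\<close>

definition one_sided_chores :: "nat \<Rightarrow> nat set \<Rightarrow> real" where
  "one_sided_chores i S = - real (card (S \<inter> (if i = 1 then {0, 1} else {1})))"

lemma agents_2: "agents 2 = {1, 2}"
  by (auto simp: agents_def)

lemma binary_chores_instance_one_sided: "binary_chores_instance 2 {0, 1} one_sided_chores"
proof -
  \<comment> \<open>Every index other than 1 carries the valuation of agent 2, so \<open>i\<close>
    can stay arbitrary. Additivity is checked on each of the four bundles.\<close>
  have "additive_on {0, 1} (one_sided_chores i)" for i
    unfolding additive_on_def
  proof (intro conjI allI impI)
    fix S :: "nat set"
    assume "S \<subseteq> {0, 1}"
    then have "S \<in> Pow {0, 1}" by simp
    then have "S \<in> {{}, {0}, {1}, {0, 1}}" by (auto simp: Pow_insert)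
    then show "one_sided_chores i S = (\<Sum>c\<in>S. one_sided_chores i {c})"
      by (elim insertE) (simp_all add: one_sided_chores_def)
  qed (simp add: one_sided_chores_def)
  then show ?thesis
    by (auto simp: binary_chores_instance_def fair_instance_def one_sided_chores_def)
qed

text \<open>The constant base value -1 serves every chore. This carries the counterexample over to
  the class that the guarantee is about.\<close>

lemma binary_imp_restricted_additive:
  assumes "binary_chores_instance n M v"
  shows "restricted_additive_chores_instance n M v"
proof -
  have "\<forall>i\<in>agents n. \<forall>c\<in>M. v i {c} \<in> {0, - 1}"
    using assms by (simp add: binary_chores_instance_def)
  then have "\<exists>b :: 'a \<Rightarrow> real. \<forall>i\<in>agents n. \<forall>c\<in>M. v i {c} \<in> {0, b c}"
    by (intro exI[of _ "\<lambda>_. - 1"])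
  with assms show ?thesis
    unfolding restricted_additive_chores_instance_def chores_instance_def
      binary_chores_instance_def by force
qed

text \<open>The disjunction lets one case analysis serve both EFX and EQX. The second equation
  reflects that agent 2 values the whole set at -1.\<close>

lemma one_sided_chores_ex_post_values:
  assumes "allocation 2 {0, 1} A"
    and "EFX 2 one_sided_chores A \<or> EQX 2 one_sided_chores A"
  shows "one_sided_chores 1 (A 1) = -1"
    and "one_sided_chores 2 (A 1) = -1 - one_sided_chores 2 (A 2)"
proof -
  have un: "A 1 \<union> A 2 = {0, 1}" and disj: "A 1 \<inter> A 2 = {}"
    using assms(1) by (auto simp: allocation_def agents_2 disjoint_family_on_def)
  from un have "A 1 \<in> Pow {0, 1}" by blast
  then consider "A 1 = {}" | "A 1 = {0}" | "A 1 = {1}" | "A 1 = {0, 1}"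
    by (auto simp: Pow_insert)
  moreover have "A 2 = {0, 1} - A 1" using disj un by blast
  ultimately consider "A 1 = {}" "A 2 = {0, 1}" | "A 1 = {0}" "A 2 = {1}"
    | "A 1 = {1}" "A 2 = {0}" | "A 1 = {0, 1}" "A 2 = {}"
    by cases (simp_all add: insert_Diff_if)
  then have "one_sided_chores 1 (A 1) = -1 \<and>
      one_sided_chores 2 (A 1) = -1 - one_sided_chores 2 (A 2)"
  proof cases
    case 1
    \<comment> \<open>Chore 0 costs agent 2 nothing, so removing it still leaves -1, against 0 for
      the empty bundle. The evaluator \<open>i\<close> is free because EFX compares with
      \<open>i = 2\<close> and EQX with \<open>i = 1\<close>.\<close>
    then have "one_sided_chores 2 (A 2 - {0}) < one_sided_chores i (A 1)" for i
      by (simp add: one_sided_chores_def)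
    moreover have "\<exists>i. one_sided_chores i (A 1) \<le> one_sided_chores 2 (A 2 - {0})"
    proof -
      from 1 have "0 \<in> A 2" by simp
      then show ?thesis using assms(2) unfolding EFX_def EQX_def agents_2 by blast
    qed
    ultimately have False by (meson not_le)
    then show ?thesis ..
  next
    case 4
    \<comment> \<open>Agent 1 dislikes both chores, so one removal still leaves -1. Now EFX uses
      \<open>i = 1\<close> and EQX uses \<open>i = 2\<close>.\<close>
    then have "one_sided_chores 1 (A 1 - {0}) < one_sided_chores i (A 2)" for i
      by (simp add: one_sided_chores_def insert_Diff_if)
    moreover have "\<exists>i. one_sided_chores i (A 2) \<le> one_sided_chores 1 (A 1 - {0})"
    proof -
      from 4 have "0 \<in> A 1" by simp
      then show ?thesis using assms(2) unfolding EFX_def EQX_def agents_2 by blast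
    qed
    ultimately have False by (meson not_le)
    then show ?thesis ..
  qed (simp_all add: one_sided_chores_def)
  then show "one_sided_chores 1 (A 1) = -1"
    and "one_sided_chores 2 (A 1) = -1 - one_sided_chores 2 (A 2)" by auto
qed

text \<open>The argument runs on expectations: EQ makes agent 2's own expected value -1, hence agent
  1's bundle has expected value 0 to agent 2, against EF. The support may even mix EFX and EQX
  allocations.\<close>

lemma one_sided_chores_no_lottery:
  assumes D: "randomized_allocation 2 {0, 1} D"
    and EF: "ex_ante_EF 2 one_sided_chores D" and EQ: "ex_ante_EQ 2 one_sided_chores D"
  shows "\<not> ex_post (\<lambda>A. EFX 2 one_sided_chores A \<or> EQX 2 one_sided_chores A) D"
proof
  assume X: "ex_post (\<lambda>A. EFX 2 one_sided_chores A \<or> EQX 2 one_sided_chores A) D"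
  let ?v = one_sided_chores and ?E = "measure_pmf.expectation D"
  \<comment> \<open>Finite support gives integrability, which splitting the expectation of a
    difference requires.\<close>
  have int: "integrable (measure_pmf D) f" for f :: "_ \<Rightarrow> real"
    using D by (intro integrable_measure_pmf_finite) (auto simp: randomized_allocation_def)
  have vals: "?v 1 (A 1) = -1" "?v 2 (A 1) = -1 - ?v 2 (A 2)" if "A \<in> set_pmf D" for A
    using one_sided_chores_ex_post_values[of A] D X that
    by (auto simp: randomized_allocation_def ex_post_def)
  \<comment> \<open>The values are known only on the support, hence almost everywhere. Unfolding
    \<open>One_nat_def\<close> matches the form to which simp rewrites the index 1.\<close>
  have "?E (\<lambda>A. ?v 1 (A 1)) = ?E (\<lambda>_. -1)"
    by (intro integral_cong_AE) (auto simp: AE_measure_pmf_iff vals(1)[unfolded One_nat_def])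
  then have "?E (\<lambda>A. ?v 1 (A 1)) = -1" by simp
  moreover have "?E (\<lambda>A. ?v 2 (A 1)) = ?E (\<lambda>A. -1 - ?v 2 (A 2))"
    by (intro integral_cong_AE) (auto simp: AE_measure_pmf_iff vals(2)[unfolded One_nat_def])
  moreover have "?E (\<lambda>A. -1 - ?v 2 (A 2)) = -1 - ?E (\<lambda>A. ?v 2 (A 2))"
    by (subst Bochner_Integration.integral_diff) (auto intro: int)
  moreover have "?E (\<lambda>A. ?v 1 (A 1)) = ?E (\<lambda>A. ?v 2 (A 2))"
    using EQ unfolding ex_ante_EQ_def agents_2 by blast
  moreover have "?E (\<lambda>A. ?v 2 (A 2)) \<ge> ?E (\<lambda>A. ?v 2 (A 1))"
    using EF unfolding ex_ante_EF_def agents_2 by blast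
  ultimately show False by linarith
qed

theorem proposition12:
  "(\<exists>(M :: nat set) v. binary_chores_instance 2 M v \<and> card M = 2 \<and>
      \<not> (\<exists>D. randomized_allocation 2 M D \<and> ex_ante_EF 2 v D \<and> ex_ante_EQ 2 v D \<and>
             ex_post (EFX 2 v) D) \<and>
      \<not> (\<exists>D. randomized_allocation 2 M D \<and> ex_ante_EF 2 v D \<and> ex_ante_EQ 2 v D \<and>
             ex_post (EQX 2 v) D)) \<and>
   \<not> (\<forall>n (M :: nat set) v. restricted_additive_chores_instance n M v \<longrightarrow>
        (\<exists>D. randomized_allocation n M D \<and> ex_ante_EF n v D \<and> ex_ante_EQ n v D \<and>
             ex_post (EFX n v) D \<and> ex_post (EQ1 n v) D)) \<and>
   \<not> (\<forall>n (M :: nat set) v. restricted_additive_chores_instance n M v \<longrightarrow>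
        (\<exists>D. randomized_allocation n M D \<and> ex_ante_EF n v D \<and> ex_ante_EQ n v D \<and>
             ex_post (EF1 n v) D \<and> ex_post (EQX n v) D))"
proof -
  note no = one_sided_chores_no_lottery[unfolded ex_post_def]
  have noX: "\<not> (\<exists>D. randomized_allocation 2 {0, 1} D \<and> ex_ante_EF 2 one_sided_chores D \<and>
      ex_ante_EQ 2 one_sided_chores D \<and> ex_post (EFX 2 one_sided_chores) D)"
    and noQ: "\<not> (\<exists>D. randomized_allocation 2 {0, 1} D \<and> ex_ante_EF 2 one_sided_chores D \<and>
      ex_ante_EQ 2 one_sided_chores D \<and> ex_post (EQX 2 one_sided_chores) D)"
    unfolding ex_post_def using no by blast+
  have "card {0, 1 :: nat} = 2" by simp
  \<comment> \<open>Each strengthened guarantee, applied to this instance, would yield a lottery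
    excluded by \<open>noX\<close> or \<open>noQ\<close>.\<close>
  with noX noQ binary_chores_instance_one_sided
    binary_imp_restricted_additive[OF binary_chores_instance_one_sided]
  show ?thesis by (intro conjI notI) (blast, metis, metis)
qed

end
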